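(* Let $Q\subset E$ be convex, $f:Q\to\mathbb{R}$ convex, $L>0$, $\delta_k\ge 0$ and $\widetilde\delta_k\ge0$ for $k\ge 0$, and suppose that for every $k\ge 0$ and every $y\in Q$ there is a $(\delta_k,L)$-model $\psi_{\delta_k}(\cdot,y)$ of $f$ at $y$ with respect to $V[y](x)$, with approximate values $f_{\delta_k}(y)$. Let $x_0\in Q$, $0<L_0\le L$, and let $x_*$ be a minimizer of $f$ on $Q$ nearest to $x_0$ in the sense that it minimizes $V[x_0](\cdot)$ among minimizers of $f$; assume $V[x_0](x_* )\le R^2$. Let $(x_k),(\alpha_k),(A_k)$ be generated by the adaptive gradient method with inexact auxiliary solutions described in the context, and $\bar x_N=\frac1{A_N}\sum_{k=0}^{N-1}\alpha_{k+1}x_{k+1}$. Then for every $N\ge1$ $$f(\bar x_N)-f(x_* )\le\frac{R^2}{A_N}+\frac1{A_N}\sum_{k=0}^{N-1}\alpha_{k+1}\widetilde\delta_k+\frac2{A_N}\sum_{k=0}^{N-1}\alpha_{k+1}\delta_k\le\frac{2LR^2}{N}+\frac1{A_N}\sum_{k=0}^{N-1}\alpha_{k+1}\widetilde\delta_k+\frac2{A_N}\sum_{k=0}^{N-1}\alpha_{k+1}\delta_k .$$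
   Context: $E$ is a finite-dimensional real vector space. $d$ is a convex differentiable function on $Q$ and $V[y](x)=d(x)-d(y)-\langle\nabla d(y),x-y\rangle$ (strong convexity of $d$ is not assumed). Model. For $\delta\ge 0$, $L>0$, $\psi_\delta(x,y)$ is a $(\delta,L)$-model of $f$ at $y\in Q$ w.r.t. $V[y](x)$ if there is $f_\delta(y)\in[f(y)-\delta,f(y)]$ such that for all $x\in Q$ $$0\le f(x)-\bigl(f_\delta(y)+\psi_\delta(x,y)\bigr)\le L\,V[y](x)+\delta,$$ $\psi_\delta(x,y)$ is convex in $x\in Q$, and $\psi_\delta(x,x)=0$ for all $x\in Q$. Inexact minimizer. For convex $\Psi$ on $Q$ and $\widetilde\delta\ge0$, $\arg\min^{\widetilde\delta}_{x\in Q}\Psi(x)$ denotes some point $\widetilde x\in Q$ for which there exists $h\in\partial\Psi(\widetilde x)$ with $\langle h,x-\widetilde x\rangle\ge-\widetilde\delta$ for all $x\in Q$. Method. Put $\alpha_0=A_0=0$. For $k=0,1,2,\dots$: find the smallest integer $i_k\ge 0$ such that, with $L_{k+1}=2^{i_k-1}L_k$, $\alpha_{k+1}=1/L_{k+1}$, $A_{k+1}=A_k+\alpha_{k+1}$ and $$x_{k+1}={\arg\min_{x\in Q}}^{\widetilde\delta_k}\ L_{k+1}\bigl(V[x_k](x)+\alpha_{k+1}\psi_{\delta_k}(x,x_k)\bigr),$$ one has $$f_{\delta_k}(x_{k+1})\le f_{\delta_k}(x_k)+\psi_{\delta_k}(x_{k+1},x_k)+L_{k+1}V[x_k](x_{k+1})+\delta_k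 .$$ *)

theory Defs
  imports "HOL-Analysis.Analysis"
begin

text \<open>
  The dual of the finite-dimensional space \<open>'a\<close> is \<open>'a \<Rightarrow>\<^sub>L real\<close>, and the pairing of a functional
  with a vector is \<open>blinfun_apply\<close>. The norm on \<open>'a\<close> only provides the topology in which
  differentiability is understood.
\<close>

text \<open>
  A choice of gradient, as \<open>d\<close> is only given on \<open>Q\<close> and \<open>Q\<close> may have empty interior. For convex \<open>Q\<close>
  and \<open>x\<close>, \<open>y\<close> in \<open>Q\<close> the value of \<open>grad y\<close> at \<open>x - y\<close> does not depend on the choice.
\<close>

definition gradient_on :: "'a::real_normed_vector set \<Rightarrow> ('a \<Rightarrow> real) \<Rightarrow> ('a \<Rightarrow> 'a \<Rightarrow>\<^sub>L real) \<Rightarrow> bool" where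
  "gradient_on Q d grad \<longleftrightarrow>
     (\<forall>y\<in>Q. (d has_derivative blinfun_apply (grad y)) (at y within Q))"

text \<open>\<open>bregman d grad y x\<close> is \<open>V[y](x)\<close>: the base point comes first.\<close>

definition bregman :: "('a::real_normed_vector \<Rightarrow> real) \<Rightarrow> ('a \<Rightarrow> 'a \<Rightarrow>\<^sub>L real) \<Rightarrow> 'a \<Rightarrow> 'a \<Rightarrow> real" where
  "bregman d grad y x = d x - d y - blinfun_apply (grad y) (x - y)"

text \<open>
  \<open>fd\<close> is the approximate value of \<open>f\<close> at \<open>y\<close>; the base point is the second argument of \<open>\<psi>\<close>.
\<close>

definition inexact_model ::
  "'a::real_normed_vector set \<Rightarrow> ('a \<Rightarrow> 'a \<Rightarrow> real) \<Rightarrow> ('a \<Rightarrow> real) \<Rightarrow> real \<Rightarrow> real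
     \<Rightarrow> real \<Rightarrow> ('a \<Rightarrow> 'a \<Rightarrow> real) \<Rightarrow> 'a \<Rightarrow> bool" where
  "inexact_model Q V f \<delta> L fd \<psi> y \<longleftrightarrow>
     fd \<in> {f y - \<delta>..f y} \<and>
     (\<forall>x\<in>Q. 0 \<le> f x - (fd + \<psi> x y) \<and> f x - (fd + \<psi> x y) \<le> L * V y x + \<delta>) \<and>
     convex_on Q (\<lambda>x. \<psi> x y) \<and>
     (\<forall>x\<in>Q. \<psi> x x = 0)"

definition subdifferential_on ::
  "'a::real_normed_vector set \<Rightarrow> ('a \<Rightarrow> real) \<Rightarrow> 'a \<Rightarrow> ('a \<Rightarrow>\<^sub>L real) set" where
  "subdifferential_on Q \<Psi> z = {h. \<forall>x\<in>Q. \<Psi> z + blinfun_apply h (x - z) \<le> \<Psi> x}"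

definition inexact_minimizer ::
  "'a::real_normed_vector set \<Rightarrow> ('a \<Rightarrow> real) \<Rightarrow> real \<Rightarrow> 'a \<Rightarrow> bool" where
  "inexact_minimizer Q \<Psi> \<delta> z \<longleftrightarrow>
     z \<in> Q \<and> (\<exists>h\<in>subdifferential_on Q \<Psi> z. \<forall>x\<in>Q. blinfun_apply h (x - z) \<ge> - \<delta>)"

text \<open>
  One iteration from \<open>y\<close> with current constant \<open>l\<close>. Trial \<open>j\<close> uses the constant \<open>2 powi (j - 1) * l\<close>
  and computes some inexact minimizer \<open>z j\<close> of the auxiliary problem. As inexact minimizers need not
  be unique, the smallest accepted \<open>i\<close> is understood relative to the points \<open>z j\<close> computed in the
  trials; the point computed in the accepted trial is the next iterate.
\<close>

definition trial_const :: "real \<Rightarrow> nat \<Rightarrow> real" where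
  "trial_const l j = 2 powi (int j - 1) * l"

definition trial_objective ::
  "('a \<Rightarrow> 'a \<Rightarrow> real) \<Rightarrow> ('a \<Rightarrow> 'a \<Rightarrow> real) \<Rightarrow> 'a \<Rightarrow> real \<Rightarrow> 'a \<Rightarrow> real" where
  "trial_objective V \<psi> y l = (\<lambda>x. l * (V y x + (1 / l) * \<psi> x y))"

definition trial_accepted ::
  "('a \<Rightarrow> 'a \<Rightarrow> real) \<Rightarrow> ('a \<Rightarrow> real) \<Rightarrow> ('a \<Rightarrow> 'a \<Rightarrow> real) \<Rightarrow> real
     \<Rightarrow> 'a \<Rightarrow> real \<Rightarrow> 'a \<Rightarrow> bool" where
  "trial_accepted V fd \<psi> \<delta> y l z \<longleftrightarrow> fd z \<le> fd y + \<psi> z y + l * V y z + \<delta>"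

definition adaptive_step ::
  "'a::real_normed_vector set \<Rightarrow> ('a \<Rightarrow> 'a \<Rightarrow> real) \<Rightarrow> ('a \<Rightarrow> real) \<Rightarrow> ('a \<Rightarrow> 'a \<Rightarrow> real)
     \<Rightarrow> real \<Rightarrow> real \<Rightarrow> 'a \<Rightarrow> real \<Rightarrow> nat \<Rightarrow> 'a \<Rightarrow> bool" where
  "adaptive_step Q V fd \<psi> \<delta> \<delta>' y l i y' \<longleftrightarrow>
     (\<exists>z :: nat \<Rightarrow> 'a.
        (\<forall>j\<le>i. inexact_minimizer Q (trial_objective V \<psi> y (trial_const l j)) \<delta>' (z j)) \<and>
        trial_accepted V fd \<psi> \<delta> y (trial_const l i) (z i) \<and>
        (\<forall>j<i. \<not> trial_accepted V fd \<psi> \<delta> y (trial_const l j) (z j)) \<and>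
        y' = z i)"

definition adaptive_gradient_run ::
  "'a::real_normed_vector set \<Rightarrow> ('a \<Rightarrow> 'a \<Rightarrow> real) \<Rightarrow> (nat \<Rightarrow> 'a \<Rightarrow> real)
     \<Rightarrow> (nat \<Rightarrow> 'a \<Rightarrow> 'a \<Rightarrow> real) \<Rightarrow> (nat \<Rightarrow> real) \<Rightarrow> (nat \<Rightarrow> real)
     \<Rightarrow> (nat \<Rightarrow> nat) \<Rightarrow> (nat \<Rightarrow> real) \<Rightarrow> (nat \<Rightarrow> real) \<Rightarrow> (nat \<Rightarrow> real) \<Rightarrow> (nat \<Rightarrow> 'a) \<Rightarrow> bool" where
  "adaptive_gradient_run Q V fd \<psi> \<delta> \<delta>' i l \<alpha> A x \<longleftrightarrow>
     \<alpha> 0 = 0 \<and> A 0 = 0 \<and>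
     (\<forall>k. l (Suc k) = trial_const (l k) (i k) \<and>
          \<alpha> (Suc k) = 1 / l (Suc k) \<and>
          A (Suc k) = A k + \<alpha> (Suc k) \<and>
          adaptive_step Q V (fd k) (\<psi> k) (\<delta> k) (\<delta>' k) (x k) (l k) (i k) (x (Suc k)))"

end

theory Submission
  imports Defs
begin

text \<open>
  Comparing the auxiliary objective at an inexact minimizer \<open>z\<close> with its values along the segment from
  \<open>z\<close> to \<open>u\<close>, and letting the segment shrink, replaces the Bregman term by its derivative while
  convexity keeps the increment of the model term linear. The three-point identity for \<open>V\<close> then gives
  \<open>\<psi>(z) + l V[y](z) \<le> \<psi>(u) + l V[y](u) - l V[z](u) + \<delta>'\<close>. Together with the acceptance test
  this bounds \<open>f(z) - f(u)\<close> by \<open>l (V[y](u) - V[z](u)) + \<delta>' + 2\<delta>\<close>, which telescopes after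
  division by \<open>l\<close>. A trial constant of at least \<open>L\<close> is always accepted, so the constants never
  exceed \<open>2L\<close>.
\<close>

text \<open>The derivative is only relative to \<open>Q\<close>, which may have empty interior, so
  it is read off along a segment: convexity keeps the segment inside \<open>Q\<close>, and the chain
  rule reduces the claim to a one-sided derivative at 0 of a real function.\<close>

lemma has_derivative_within_segment_tendsto:
  fixes d :: "'a::real_normed_vector \<Rightarrow> real"
  assumes "(d has_derivative D) (at z within Q)" "convex Q" "z \<in> Q" "u \<in> Q"
  shows "((\<lambda>t. (d (z + t *\<^sub>R (u - z)) - d z) / t) \<longlongrightarrow> D (u - z)) (at_right 0)"
proof -
  let ?g = "\<lambda>t::real. z + t *\<^sub>R (u - z)"
  have seg: "?g ` {0..1} \<subseteq> Q"
    using convexD_alt[OF assms(2,3,4)] by (auto simp: algebra_simps)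
  have "(?g has_derivative (\<lambda>t. t *\<^sub>R (u - z))) (at 0 within {0..1})"
    by (auto intro!: derivative_eq_intros)
  moreover have "(d has_derivative D) (at (?g 0) within ?g ` {0..1})"
    using has_derivative_subset[OF assms(1) seg] by simp
  ultimately have "((\<lambda>t. d (?g t)) has_derivative (\<lambda>t. D (t *\<^sub>R (u - z)))) (at 0 within {0..1})"
    by (rule has_derivative_in_compose)
  moreover have "D (t *\<^sub>R (u - z)) = D (u - z) * t" for t
    using linear_cmul[OF has_derivative_linear[OF assms(1)]] by simp
  ultimately have "((\<lambda>t. d (?g t)) has_field_derivative D (u - z)) (at 0 within {0..1})"
    by (simp add: has_field_derivative_def)
  then show ?thesis
    by (simp add: has_field_derivative_iff at_within_Icc_at_right)
qed

text \<open>Convexity bounds every difference quotient of \<open>d\<close> from \<open>y\<close>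
  towards \<open>x\<close> by \<open>d x - d y\<close>; the limit at 0 inherits the bound.\<close>

lemma bregman_nonneg:
  assumes "convex Q" "convex_on Q d" "gradient_on Q d grad" "y \<in> Q" "x \<in> Q"
  shows "bregman d grad y x \<ge> 0"
proof -
  have "((\<lambda>t. (d (y + t *\<^sub>R (x - y)) - d y) / t) \<longlongrightarrow> grad y (x - y)) (at_right 0)"
    using assms by (intro has_derivative_within_segment_tendsto) (auto simp: gradient_on_def)
  moreover have "\<forall>\<^sub>F t in at_right 0. (d (y + t *\<^sub>R (x - y)) - d y) / t \<le> d x - d y"
  proof (rule eventually_at_rightI)
    fix t :: real assume t: "t \<in> {0<..<1}"
    then have "d ((1 - t) *\<^sub>R y + t *\<^sub>R x) \<le> (1 - t) * d y + t * d x"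
      using convex_onD[OF assms(2)] assms(4,5) by simp
    then have "d (y + t *\<^sub>R (x - y)) - d y \<le> (d x - d y) * t"
      by (simp add: algebra_simps)
    then show "(d (y + t *\<^sub>R (x - y)) - d y) / t \<le> d x - d y"
      using t by (simp add: pos_divide_le_eq)
  qed simp
  ultimately have "grad y (x - y) \<le> d x - d y"
    by (rule tendsto_upperbound) simp
  then show ?thesis by (simp add: bregman_def)
qed

text \<open>The values of \<open>d\<close> cancel on the right. The left side is the derivative of
  \<open>V y\<close> at \<open>z\<close> in the direction \<open>u - z\<close>.\<close>

lemma bregman_three_point:
  "blinfun_apply (grad z) (u - z) - blinfun_apply (grad y) (u - z)
     = bregman d grad y u - bregman d grad y z - bregman d grad z u"
  by (simp add: bregman_def blinfun.diff_right)

text \<open>The subgradient belongs to the whole objective and does not come split into a Bregman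
  part and a model part. Testing it at points of the segment close to \<open>z\<close> separates the
  two.\<close>

lemma inexact_minimizer_three_point:
  fixes Q :: "'a::real_normed_vector set"
    and d :: "'a \<Rightarrow> real" and grad :: "'a \<Rightarrow> 'a \<Rightarrow>\<^sub>L real"
  defines "V \<equiv> bregman d grad"
  assumes "convex Q" "gradient_on Q d grad" "convex_on Q (\<lambda>x. \<psi> x y)" "l > 0"
    and min: "inexact_minimizer Q (trial_objective V \<psi> y l) \<delta>' z" and "u \<in> Q"
  shows "\<psi> z y + l * V y z \<le> \<psi> u y + l * V y u - l * V z u + \<delta>'"
proof -
  \<comment> \<open>As \<open>l > 0\<close>, the factor \<open>l * (1 / l)\<close> cancels and the
    objective becomes \<open>l * V y w + \<psi> w y\<close>.\<close>
  from min obtain h where z: "z \<in> Q"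
    and h: "\<And>w. w \<in> Q \<Longrightarrow>
              l * V y z + \<psi> z y + blinfun_apply h (w - z) \<le> l * V y w + \<psi> w y"
    and hu: "blinfun_apply h (u - z) \<ge> - \<delta>'"
    using \<open>u \<in> Q\<close> \<open>l > 0\<close>
    by (force simp: inexact_minimizer_def subdifferential_on_def trial_objective_def distrib_left)
  let ?w = "\<lambda>t::real. z + t *\<^sub>R (u - z)"
  \<comment> \<open>This is the difference quotient of \<open>l * V y\<close> along the segment; the
    linear part of \<open>V y\<close> contributes exactly, without a limit.\<close>
  let ?q = "\<lambda>t. l * ((d (?w t) - d z) / t - blinfun_apply (grad y) (u - z))"
  have "(?q \<longlongrightarrow> l * (grad z (u - z) - grad y (u - z))) (at_right 0)"
    using assms z
    by (intro tendsto_intros has_derivative_within_segment_tendsto) (auto simp: gradient_on_def)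
  \<comment> \<open>The subgradient term is at least \<open>- t * \<delta>'\<close>, and the model
    grows by at most \<open>t * (\<psi> u y - \<psi> z y)\<close>. Every term carries the factor
    \<open>t\<close>, which cancels.\<close>
  moreover have "\<forall>\<^sub>F t in at_right 0. - \<delta>' - (\<psi> u y - \<psi> z y) \<le> ?q t"
  proof (rule eventually_at_rightI)
    fix t :: real assume t: "t \<in> {0<..<1}"
    have w: "?w t = (1 - t) *\<^sub>R z + t *\<^sub>R u" by (simp add: algebra_simps)
    have "?w t \<in> Q"
      using convexD_alt[OF \<open>convex Q\<close> z \<open>u \<in> Q\<close>, of t] t by (simp add: w)
    then have "l * V y z + \<psi> z y + t * blinfun_apply h (u - z) \<le> l * V y (?w t) + \<psi> (?w t) y"
      using h[of "?w t"] by (simp add: blinfun.scaleR_right)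
    moreover have "\<psi> (?w t) y \<le> (1 - t) * \<psi> z y + t * \<psi> u y"
      unfolding w using convex_onD[OF assms(4), of t z u] t z \<open>u \<in> Q\<close> by simp
    moreover have "V y (?w t) - V y z = t * ((d (?w t) - d z) / t - grad y (u - z))"
    proof -
      have "blinfun_apply (grad y) (?w t - y) - grad y (z - y) = t * grad y (u - z)"
        by (simp add: blinfun.diff_right blinfun.add_right blinfun.scaleR_right)
      moreover have "t * ((d (?w t) - d z) / t) = d (?w t) - d z"
        using t by simp
      ultimately show ?thesis
        unfolding V_def bregman_def right_diff_distrib by linarith
    qed
    then have "l * V y (?w t) - l * V y z = t * ?q t"
      by (metis mult.left_commute right_diff_distrib)
    moreover have "t * blinfun_apply h (u - z) \<ge> t * - \<delta>'"
      using hu t by (intro mult_left_mono) auto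
    ultimately have "t * (- \<delta>' - (\<psi> u y - \<psi> z y)) \<le> t * ?q t"
      by (simp only: left_diff_distrib right_diff_distrib)
    then show "- \<delta>' - (\<psi> u y - \<psi> z y) \<le> ?q t"
      using t by (simp only: mult_le_cancel_left_pos greaterThanLessThan_iff)
  qed simp
  ultimately have "- \<delta>' - (\<psi> u y - \<psi> z y) \<le> l * (grad z (u - z) - grad y (u - z))"
    by (rule tendsto_lowerbound) simp
  then show ?thesis
    unfolding bregman_three_point[where d = d] V_def by (simp add: algebra_simps)
qed

lemma trial_const_pos: "l > 0 \<Longrightarrow> trial_const l j > 0"
  by (simp add: trial_const_def)

lemma trial_const_0: "trial_const l 0 = l / 2"
  by (simp add: trial_const_def power_int_minus)

lemma trial_const_Suc: "trial_const l (Suc j) = 2 * trial_const l j"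
proof -
  have "(2::real) powi (int (Suc j) - 1) = 2 powi ((int j - 1) + 1)" by simp
  also have "\<dots> = 2 * 2 powi (int j - 1)" by (subst power_int_add) auto
  finally show ?thesis by (simp add: trial_const_def)
qed

text \<open>The test is the upper model bound at \<open>y\<close> with \<open>fd z\<close> for
  \<open>f z\<close> and \<open>l\<close> for \<open>L\<close>. The first change only lowers the
  left side, the second only raises the right side because \<open>V y z\<close> is
  nonnegative.\<close>

lemma trial_accepted_if_ge:
  assumes "inexact_model Q V f \<delta> L (fd y) \<psi> y" "inexact_model Q V f \<delta> L (fd z) \<psi> z"
    and "z \<in> Q" "V y z \<ge> 0" "L \<le> l"
  shows "trial_accepted V fd \<psi> \<delta> y l z"
proof -
  have "fd z \<le> f z" using assms(2) by (simp add: inexact_model_def)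
  also have "f z \<le> fd y + \<psi> z y + L * V y z + \<delta>"
    using assms(1,3) by (force simp: inexact_model_def)
  also have "L * V y z \<le> l * V y z" using assms(4,5) by (simp add: mult_right_mono)
  finally show ?thesis by (simp add: trial_accepted_def)
qed

text \<open>Either the first trial is accepted and the constant is halved, or the accepted constant
  is twice a rejected one, which must lie below \<open>L\<close>.\<close>

lemma adaptive_step_const_le:
  assumes model: "\<And>z. z \<in> Q \<Longrightarrow> inexact_model Q V f \<delta> L (fd z) \<psi> z"
    and V: "\<And>z. z \<in> Q \<Longrightarrow> V y z \<ge> 0"
    and "y \<in> Q" "0 < l" "l \<le> 2 * L"
    and step: "adaptive_step Q V fd \<psi> \<delta> \<delta>' y l i y'"
  shows "trial_const l i \<le> 2 * L"
proof (cases i)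
  case 0
  then show ?thesis using assms by (simp add: trial_const_0)
next
  case (Suc j)
  with step obtain z where z: "inexact_minimizer Q (trial_objective V \<psi> y (trial_const l j)) \<delta>' z"
    and rej: "\<not> trial_accepted V fd \<psi> \<delta> y (trial_const l j) z"
    unfolding adaptive_step_def by (meson lessI less_imp_le_nat)
  have "z \<in> Q" using z by (simp add: inexact_minimizer_def)
  then have "trial_const l j < L"
    using rej trial_accepted_if_ge[of Q V f \<delta> L fd y \<psi> z "trial_const l j"] model V \<open>y \<in> Q\<close>
    by force
  then show ?thesis using Suc by (simp add: trial_const_Suc)
qed

text \<open>One \<open>\<delta>\<close> is the slack of the acceptance test, the other the gap
  between \<open>f y'\<close> and \<open>fd y'\<close>. The lower model bound at \<open>u\<close>
  adds no error, and \<open>\<delta>'\<close> comes from the inexact minimization.\<close>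

lemma adaptive_step_descent:
  fixes Q :: "'a::real_normed_vector set"
    and d :: "'a \<Rightarrow> real" and grad :: "'a \<Rightarrow> 'a \<Rightarrow>\<^sub>L real"
  defines "V \<equiv> bregman d grad"
  assumes "convex Q" "gradient_on Q d grad"
    and model: "\<And>z. z \<in> Q \<Longrightarrow> inexact_model Q V f \<delta> L (fd z) \<psi> z"
    and "y \<in> Q" "0 < l"
    and step: "adaptive_step Q V fd \<psi> \<delta> \<delta>' y l i y'"
    and "u \<in> Q"
  shows "y' \<in> Q"
    and "f y' - f u \<le> trial_const l i * (V y u - V y' u) + \<delta>' + 2 * \<delta>"
proof -
  let ?l = "trial_const l i"
  have min: "inexact_minimizer Q (trial_objective V \<psi> y ?l) \<delta>' y'"
    and acc: "fd y' \<le> fd y + \<psi> y' y + ?l * V y y' + \<delta>"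
    using step by (auto simp: adaptive_step_def trial_accepted_def)
  show y': "y' \<in> Q" using min by (simp add: inexact_minimizer_def)
  have "\<psi> y' y + ?l * V y y' \<le> \<psi> u y + ?l * V y u - ?l * V y' u + \<delta>'"
    unfolding V_def
  proof (rule inexact_minimizer_three_point)
    show "convex_on Q (\<lambda>x. \<psi> x y)" using model[OF \<open>y \<in> Q\<close>] by (simp add: inexact_model_def)
  qed (use assms min trial_const_pos in auto)
  moreover have "f y' - \<delta> \<le> fd y'" using model[OF y'] by (simp add: inexact_model_def)
  moreover have "fd y + \<psi> u y \<le> f u"
    using model[OF \<open>y \<in> Q\<close>] \<open>u \<in> Q\<close> by (simp add: inexact_model_def)
  ultimately show "f y' - f u \<le> ?l * (V y u - V y' u) + \<delta>' + 2 * \<delta>"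
    using acc unfolding right_diff_distrib by linarith
qed

theorem theorem15:
  fixes Q :: "'a::real_normed_vector set"
    and f d :: "'a \<Rightarrow> real"
    and grad :: "'a \<Rightarrow> 'a \<Rightarrow>\<^sub>L real"
    and fd :: "nat \<Rightarrow> 'a \<Rightarrow> real"
    and \<psi> :: "nat \<Rightarrow> 'a \<Rightarrow> 'a \<Rightarrow> real"
    and \<delta> \<delta>' l \<alpha> A :: "nat \<Rightarrow> real"
    and L R :: real
    and i :: "nat \<Rightarrow> nat"
    and x :: "nat \<Rightarrow> 'a"
    and xs :: 'a
    and N :: nat
  defines "V \<equiv> bregman d grad"
    and "xbar \<equiv> (1 / A N) *\<^sub>R (\<Sum>k<N. \<alpha> (Suc k) *\<^sub>R x (Suc k))"
  assumes finite_dim: "\<exists>B :: 'a set. finite B \<and> span B = UNIV"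
    and "convex Q"
    and "convex_on Q f"
    and "convex_on Q d"
    and "gradient_on Q d grad"
    and "L > 0"
    and "\<And>k. \<delta> k \<ge> 0"
    and "\<And>k. \<delta>' k \<ge> 0"
    and model: "\<And>k y. y \<in> Q \<Longrightarrow> inexact_model Q V f (\<delta> k) L (fd k y) (\<psi> k) y"
    and "x 0 \<in> Q"
    and "0 < l 0" and "l 0 \<le> L"
    and minimizer: "is_arg_min f (\<lambda>z. z \<in> Q) xs"
    and nearest: "is_arg_min (V (x 0)) (is_arg_min f (\<lambda>z. z \<in> Q)) xs"
    and "V (x 0) xs \<le> R\<^sup>2"
    and run: "adaptive_gradient_run Q V fd \<psi> \<delta> \<delta>' i l \<alpha> A x"
    and "N \<ge> 1"
  shows "f xbar - f xs
           \<le> R\<^sup>2 / A N + (1 / A N) * (\<Sum>k<N. \<alpha> (Suc k) * \<delta>' k)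
                + (2 / A N) * (\<Sum>k<N. \<alpha> (Suc k) * \<delta> k)
       \<and> R\<^sup>2 / A N + (1 / A N) * (\<Sum>k<N. \<alpha> (Suc k) * \<delta>' k)
                + (2 / A N) * (\<Sum>k<N. \<alpha> (Suc k) * \<delta> k)
           \<le> 2 * L * R\<^sup>2 / real N + (1 / A N) * (\<Sum>k<N. \<alpha> (Suc k) * \<delta>' k)
                + (2 / A N) * (\<Sum>k<N. \<alpha> (Suc k) * \<delta> k)"
proof -
  note Q = \<open>convex Q\<close> and grad = \<open>gradient_on Q d grad\<close>
  have V_nonneg: "V y z \<ge> 0" if "y \<in> Q" "z \<in> Q" for y z
    unfolding V_def using bregman_nonneg[OF Q \<open>convex_on Q d\<close> grad that] .
  have xs: "xs \<in> Q" using minimizer by (simp add: is_arg_min_def)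
  have l_Suc: "l (Suc k) = trial_const (l k) (i k)"
    and \<alpha>_Suc: "\<alpha> (Suc k) = 1 / l (Suc k)"
    and A_Suc: "A (Suc k) = A k + \<alpha> (Suc k)"
    and step: "adaptive_step Q V (fd k) (\<psi> k) (\<delta> k) (\<delta>' k) (x k) (l k) (i k) (x (Suc k))" for k
    using run by (auto simp: adaptive_gradient_run_def)
  have A: "A n = (\<Sum>k<n. \<alpha> (Suc k))" for n
    using run by (induction n) (auto simp: adaptive_gradient_run_def)
  \<comment> \<open>The claims go through one induction since the bound on the next constant relies
    on all three for the current step.\<close>
  have inv: "x k \<in> Q \<and> 0 < l k \<and> l k \<le> 2 * L" for k
  proof (induction k)
    case 0
    then show ?case using \<open>x 0 \<in> Q\<close> \<open>0 < l 0\<close> \<open>l 0 \<le> L\<close> by auto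
  next
    case (Suc k)
    then show ?case
      using adaptive_step_descent(1)[OF Q grad model[unfolded V_def] _ _ step[unfolded V_def] xs]
        adaptive_step_const_le[OF model V_nonneg _ _ _ step] trial_const_pos l_Suc
      by simp
  qed
  then have x_in: "x k \<in> Q" and l_pos: "l k > 0" and l_le: "l k \<le> 2 * L" for k
    by auto
  have \<alpha>_pos: "\<alpha> (Suc k) > 0" for k
    using l_pos by (simp add: \<alpha>_Suc)
  \<comment> \<open>The weight \<open>1 / l (Suc k)\<close> removes the varying constant from the
    Bregman difference, so that the sum telescopes.\<close>
  have descent: "\<alpha> (Suc k) * (f (x (Suc k)) - f xs)
      \<le> (V (x k) xs - V (x (Suc k)) xs) + \<alpha> (Suc k) * \<delta>' k + 2 * (\<alpha> (Suc k) * \<delta> k)" for k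
  proof -
    have "f (x (Suc k)) - f xs
        \<le> l (Suc k) * (V (x k) xs - V (x (Suc k)) xs) + \<delta>' k + 2 * \<delta> k"
      using adaptive_step_descent(2)[OF Q grad model[unfolded V_def] x_in l_pos
          step[unfolded V_def] xs]
      by (simp add: V_def l_Suc)
    then have "\<alpha> (Suc k) * (f (x (Suc k)) - f xs)
        \<le> \<alpha> (Suc k) * (l (Suc k) * (V (x k) xs - V (x (Suc k)) xs) + \<delta>' k + 2 * \<delta> k)"
      using \<alpha>_pos by (intro mult_left_mono) (auto simp: less_imp_le)
    moreover have "\<alpha> (Suc k) * (l (Suc k) * v) = v" for v
      using l_pos[of "Suc k"] by (simp add: \<alpha>_Suc)
    ultimately show ?thesis by (simp add: distrib_left)
  qed
  have "(\<Sum>k<N. \<alpha> (Suc k) * (f (x (Suc k)) - f xs))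
      \<le> (\<Sum>k<N. V (x k) xs - V (x (Suc k)) xs) + (\<Sum>k<N. \<alpha> (Suc k) * \<delta>' k)
         + 2 * (\<Sum>k<N. \<alpha> (Suc k) * \<delta> k)"
    using sum_mono[OF descent] by (simp add: sum.distrib sum_distrib_left)
  also have "(\<Sum>k<N. V (x k) xs - V (x (Suc k)) xs) = V (x 0) xs - V (x N) xs"
    by (rule sum_lessThan_telescope')
  also have "\<dots> \<le> R\<^sup>2" using \<open>V (x 0) xs \<le> R\<^sup>2\<close> V_nonneg[OF x_in xs] by (smt (verit))
  finally have total: "(\<Sum>k<N. \<alpha> (Suc k) * (f (x (Suc k)) - f xs))
      \<le> R\<^sup>2 + (\<Sum>k<N. \<alpha> (Suc k) * \<delta>' k) + 2 * (\<Sum>k<N. \<alpha> (Suc k) * \<delta> k)" by simp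
  \<comment> \<open>The uniform bound on the constants makes \<open>A N\<close> grow at least
    linearly, which yields both its positivity and the rate in \<open>N\<close>.\<close>
  have "1 / (2 * L) \<le> \<alpha> (Suc k)" for k
    using l_le[of "Suc k"] l_pos[of "Suc k"] by (simp add: \<alpha>_Suc frac_le)
  then have "(\<Sum>k<N. 1 / (2 * L)) \<le> A N"
    unfolding A by (intro sum_mono)
  then have A_ge: "real N / (2 * L) \<le> A N" by simp
  have N_pos: "real N / (2 * L) > 0" using \<open>N \<ge> 1\<close> \<open>L > 0\<close> by simp
  with A_ge have A_pos: "A N > 0" by linarith
  have xbar: "xbar = (\<Sum>k<N. (\<alpha> (Suc k) / A N) *\<^sub>R x (Suc k))"
    by (simp add: xbar_def scaleR_sum_right)
  \<comment> \<open>Jensen's inequality: the normalized weights sum to one, which also lets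
    \<open>f xs\<close> be moved under the sum afterwards.\<close>
  have "f xbar \<le> (\<Sum>k<N. (\<alpha> (Suc k) / A N) * f (x (Suc k)))"
    unfolding xbar
  proof (rule convex_on_sum[OF _ _ \<open>convex_on Q f\<close>])
    show "(\<Sum>k<N. \<alpha> (Suc k) / A N) = 1"
      using A_pos by (simp add: A sum_divide_distrib[symmetric])
  qed (use \<open>N \<ge> 1\<close> x_in \<alpha>_pos A_pos in \<open>auto simp: less_imp_le lessThan_empty_iff\<close>)
  also have "\<dots> = (\<Sum>k<N. \<alpha> (Suc k) * (f (x (Suc k)) - f xs)) / A N + f xs"
    using A_pos
    by (simp add: A right_diff_distrib sum_subtractf sum_divide_distrib[symmetric]
        sum_distrib_right[symmetric] diff_divide_distrib)
  finally have "f xbar - f xs \<le> (\<Sum>k<N. \<alpha> (Suc k) * (f (x (Suc k)) - f xs)) / A N" by simp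
  also have "\<dots> \<le> (R\<^sup>2 + (\<Sum>k<N. \<alpha> (Suc k) * \<delta>' k) + 2 * (\<Sum>k<N. \<alpha> (Suc k) * \<delta> k)) / A N"
    using total A_pos by (simp add: divide_right_mono)
  finally have first: "f xbar - f xs \<le> R\<^sup>2 / A N + (1 / A N) * (\<Sum>k<N. \<alpha> (Suc k) * \<delta>' k)
      + (2 / A N) * (\<Sum>k<N. \<alpha> (Suc k) * \<delta> k)"
    by (simp add: add_divide_distrib)
  have "R\<^sup>2 / A N \<le> R\<^sup>2 / (real N / (2 * L))"
    using A_ge mult_pos_pos[OF A_pos N_pos] by (intro divide_left_mono) auto
  also have "\<dots> = 2 * L * R\<^sup>2 / real N" by simp
  finally show ?thesis using first by simp
qed

end
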